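(* Let $\mathbb{X}$, $\mathbb{Y}$ and $\mathbb{W}$ be quasi-Banach spaces whose quasi-norms have constants $C_{\mathbb{X}}$, $C_{\mathbb{Y}}$ and $C_{\mathbb{W}}$, and let $T\in\mathcal{L}(\mathbb{X},\mathbb{Y})$. Then the (dyadic) entropy numbers $e_n$ have the following properties. (M$_e$) $C_{\mathbb{Y}}\,e_{1}(T)\geq\Vert T\Vert\geq e_{1}(T)\geq e_{2}(T)\geq\ldots\geq0$. (A$_e$) If $S\in\mathcal{L}(\mathbb{X},\mathbb{Y})$ and $n,m\in\mathbb{N}$, then $$e_{m+n-1}(S+T)\leq C_{\mathbb{Y}}\left(e_{m}(S)+e_{n}(T)\right);$$ correspondingly, when the quasi-norm of $\mathbb{Y}$ is replaced by an equivalent $\varrho$-norm with $\varrho\in(0,1]$ (and the entropy numbers are taken with respect to it), $e_{m+n-1}(S+T)^{\varrho}\leq e_{m}(S)^{\varrho}+e_{n}(T)^{\varrho}$. (P$_e$) If $S\in\mathcal{L}(\mathbb{Y},\mathbb{W})$ and $n,m\in\mathbb{N}$, then $e_{m+n-1}(ST)\leq e_{m}(S)\,e_{n}(T)$. (C$_e$) $T$ is compact if and only if $\lim_{n\rightarrow\infty}e_{n}(T)=0$.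
   Context: Vector spaces are over $\mathbb{K}=\mathbb{R}$ or $\mathbb{C}$. A quasi-norm with constant $C\geq1$ on a vector space $\mathbb{X}$ is a map $\Vert\cdot\Vert:\mathbb{X}\to[0,\infty)$ with $\Vert x\Vert=0\iff x=0$, $\Vert\lambda x\Vert=|\lambda|\Vert x\Vert$, and $\Vert x+y\Vert\leq C(\Vert x\Vert+\Vert y\Vert)$. For $\varrho\in(0,1]$, a $\varrho$-norm satisfies instead of the last condition $\Vert x+y\Vert^{\varrho}\leq\Vert x\Vert^{\varrho}+\Vert y\Vert^{\varrho}$. Two such functionals are equivalent if each is bounded by a constant multiple of the other; every quasi-norm has an equivalent $\varrho$-norm for some $\varrho\in(0,1]$. A quasi-Banach space is a complete quasi-normed space. $\overline{B}_{\mathbb{X}}=\{x\in\mathbb{X}:\Vert x\Vert_{\mathbb{X}}\leq1\}$. $\mathcal{L}(\mathbb{X},\mathbb{Y})$ is the space of bounded linear operators, with $\Vert T\Vert=\sup_{\Vert x\Vert_{\mathbb{X}}\leq1}\Vert Tx\Vert_{\mathbb{Y}}$. An operator is compact if it maps bounded sets to relatively compact sets. For $n\in\mathbb{N}=\{1,2,\ldots\}$ and $T\in\mathcal{L}(\mathbb{X},\mathbb{Y})$, the $n$-th (dyadic) entropy number is $$e_{n}(T):=\inf\Big\{\varepsilon>0:\ \exists\,y_{1},\ldots,y_{2^{n-1}}\in\mathbb{Y}:\ T(\overline{B}_{\mathbb{X}})\subseteq\bigcup_{i=1}^{2^{n-1}}\{y_{i}+\varepsilon\overline{B}_{\mathbb{Y}}\}\Big\}.$$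 *)

theory Defs
  imports "HOL-Analysis.Analysis"
begin

text \<open>
  The scalars range over a type of class \<open>real_normed_field\<close>.  Both \<open>real\<close> and \<open>complex\<close> are
  instances, and by the theorems of Gelfand--Mazur and Ostrowski every instance is
  isometrically isomorphic to one of them.  Since a space may carry several (quasi-)norms, these
  are explicit functions on the type of vectors and not supplied by a type class.
\<close>

locale quasi_norm = vector_space scale
  for scale :: "'k::real_normed_field \<Rightarrow> 'a::ab_group_add \<Rightarrow> 'a" +
  fixes N :: "'a \<Rightarrow> real" and C :: real
  assumes const_ge_1: "C \<ge> 1"
    and nonneg: "N x \<ge> 0"
    and eq_0_iff: "N x = 0 \<longleftrightarrow> x = 0"
    and homogeneous: "N (scale c x) = norm c * N x"
    and quasi_triangle: "N (x + y) \<le> C * (N x + N y)"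

locale rho_norm = vector_space scale
  for scale :: "'k::real_normed_field \<Rightarrow> 'a::ab_group_add \<Rightarrow> 'a" +
  fixes N :: "'a \<Rightarrow> real" and \<rho> :: real
  assumes rho_pos: "0 < \<rho>" and rho_le_1: "\<rho> \<le> 1"
    and nonneg: "N x \<ge> 0"
    and eq_0_iff: "N x = 0 \<longleftrightarrow> x = 0"
    and homogeneous: "N (scale c x) = norm c * N x"
    and rho_triangle: "N (x + y) powr \<rho> \<le> N x powr \<rho> + N y powr \<rho>"

definition equivalent_norms :: "('a \<Rightarrow> real) \<Rightarrow> ('a \<Rightarrow> real) \<Rightarrow> bool" where
  "equivalent_norms N N' \<longleftrightarrow> (\<exists>c. \<forall>x. N x \<le> c * N' x) \<and> (\<exists>c. \<forall>x. N' x \<le> c * N x)"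

locale quasi_banach = quasi_norm scale N C
  for scale :: "'k::real_normed_field \<Rightarrow> 'a::ab_group_add \<Rightarrow> 'a"
    and N :: "'a \<Rightarrow> real" and C :: real +
  assumes complete:
    "(\<forall>\<epsilon>>0. \<exists>M. \<forall>m\<ge>M. \<forall>n\<ge>M. N (X m - X n) < \<epsilon>) \<Longrightarrow>
      \<exists>l. (\<lambda>n::nat. N (X n - l)) \<longlonglongrightarrow> 0"

definition unit_ball :: "('a \<Rightarrow> real) \<Rightarrow> 'a set" where
  "unit_ball N = {x. N x \<le> 1}"

text \<open>
  A ball \<open>{y. N (y - x) < \<epsilon>}\<close> of a quasi-norm need not be open in the topology below, but
  it is a neighbourhood of \<open>x\<close>.
\<close>

definition qn_topology :: "('a::ab_group_add \<Rightarrow> real) \<Rightarrow> 'a topology" where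
  "qn_topology N = topology (\<lambda>U. \<forall>x\<in>U. \<exists>\<epsilon>>0. \<forall>y. N (y - x) < \<epsilon> \<longrightarrow> y \<in> U)"

lemma openin_qn_topology:
  "openin (qn_topology N) U \<longleftrightarrow> (\<forall>x\<in>U. \<exists>\<epsilon>>0. \<forall>y. N (y - x) < \<epsilon> \<longrightarrow> y \<in> U)"
proof -
  have "istopology (\<lambda>U. \<forall>x\<in>U. \<exists>\<epsilon>>0. \<forall>y. N (y - x) < \<epsilon> \<longrightarrow> y \<in> U)"
    unfolding istopology_def
  proof (intro conjI allI impI ballI)
    fix S T x
    assume S: "\<forall>x\<in>S. \<exists>\<epsilon>>0. \<forall>y. N (y - x) < \<epsilon> \<longrightarrow> y \<in> S"
      and T: "\<forall>x\<in>T. \<exists>\<epsilon>>0. \<forall>y. N (y - x) < \<epsilon> \<longrightarrow> y \<in> T" and x: "x \<in> S \<inter> T"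
    obtain a where a: "a > 0" "\<forall>y. N (y - x) < a \<longrightarrow> y \<in> S" using S x by blast
    obtain b where b: "b > 0" "\<forall>y. N (y - x) < b \<longrightarrow> y \<in> T" using T x by blast
    show "\<exists>\<epsilon>>0. \<forall>y. N (y - x) < \<epsilon> \<longrightarrow> y \<in> S \<inter> T"
      using a b by (intro exI[of _ "min a b"]) auto
  next
    fix K x
    assume K: "\<forall>S\<in>K. \<forall>x\<in>S. \<exists>\<epsilon>>0. \<forall>y. N (y - x) < \<epsilon> \<longrightarrow> y \<in> S" and x: "x \<in> \<Union>K"
    then obtain S where "S \<in> K" "x \<in> S" by blast
    with K obtain e where "e > 0" "\<forall>y. N (y - x) < e \<longrightarrow> y \<in> S" by blast
    with \<open>S \<in> K\<close> show "\<exists>\<epsilon>>0. \<forall>y. N (y - x) < \<epsilon> \<longrightarrow> y \<in> \<Union>K" by blast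
  qed
  then show ?thesis
    unfolding qn_topology_def by (simp add: topology_inverse')
qed

definition bounded_operators ::
  "('k::real_normed_field \<Rightarrow> 'a::ab_group_add \<Rightarrow> 'a) \<Rightarrow> ('a \<Rightarrow> real) \<Rightarrow>
   ('k \<Rightarrow> 'b::ab_group_add \<Rightarrow> 'b) \<Rightarrow> ('b \<Rightarrow> real) \<Rightarrow> ('a \<Rightarrow> 'b) set" where
  "bounded_operators sX NX sY NY =
    {T. Vector_Spaces.linear sX sY T \<and> (\<exists>K. \<forall>x. NY (T x) \<le> K * NX x)}"

definition operator_norm :: "('a \<Rightarrow> real) \<Rightarrow> ('b \<Rightarrow> real) \<Rightarrow> ('a \<Rightarrow> 'b) \<Rightarrow> real" where
  "operator_norm NX NY T = (SUP x\<in>unit_ball NX. NY (T x))"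

definition compact_operator ::
  "('a \<Rightarrow> real) \<Rightarrow> ('b::ab_group_add \<Rightarrow> real) \<Rightarrow> ('a \<Rightarrow> 'b) \<Rightarrow> bool" where
  "compact_operator NX NY T \<longleftrightarrow>
    (\<forall>A. (\<exists>M. \<forall>x\<in>A. NX x \<le> M) \<longrightarrow> compactin (qn_topology NY) (qn_topology NY closure_of (T ` A)))"

text \<open>
  Only the values at \<open>n \<ge> 1\<close> are meaningful; truncated subtraction makes the value at \<open>0\<close>
  equal to the value at \<open>1\<close>.  The centres are not required to be distinct.
\<close>

definition entropy_number ::
  "('a \<Rightarrow> real) \<Rightarrow> ('k::real_normed_field \<Rightarrow> 'b::ab_group_add \<Rightarrow> 'b) \<Rightarrow> ('b \<Rightarrow> real) \<Rightarrow>
   nat \<Rightarrow> ('a \<Rightarrow> 'b) \<Rightarrow> real" where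
  "entropy_number NX sY NY n T =
    Inf {\<epsilon>. \<epsilon> > 0 \<and> (\<exists>y :: nat \<Rightarrow> 'b.
      T ` unit_ball NX \<subseteq> (\<Union>i\<in>{1..2 ^ (n - 1)}. (\<lambda>z. y i + sY (of_real \<epsilon>) z) ` unit_ball NY))}"

end

theory Submission
  imports Defs
begin

text \<open>
  The defining condition of the entropy numbers says that finitely many closed balls of radius
  \<open>\<epsilon>\<close> cover the image of the unit ball.  Everything is deduced from how such coverings behave.

  If \<open>T\<close> maps the unit ball into one ball of radius \<open>\<epsilon>\<close> around \<open>y\<close>, then, the unit ball being
  symmetric, that ball contains \<open>T x\<close> and \<open>- T x\<close>, so their difference \<open>2 T x\<close> has
  quasi-norm at most \<open>2 C \<epsilon>\<close> and the centre drops out; this bounds the operator norm by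
  \<open>C e\<^sub>1\<close>.  Coverings with \<open>k\<close> and \<open>l\<close> balls yield coverings with \<open>k * l\<close> balls both for the
  sum of two sets (\<open>covered_by_balls_add\<close>) and for the image of a covered set under an operator
  (\<open>covered_by_balls_compose\<close>).  Since \<open>2 ^ (m - 1) * 2 ^ (n - 1) = 2 ^ ((m + n - 1) - 1)\<close>, these
  are additivity and multiplicativity, once the radii decrease to the infima.  A
  \<open>\<rho>\<close>-norm is a quasi-norm as well, so the same coverings serve both versions of
  additivity; only the radius of a sum of two balls differs.

  Finally, \<open>e\<^sub>n \<rightarrow> 0\<close> says that the image of the unit ball is totally bounded, and in a
  complete space this means that its closure is compact
  (\<open>compactin_closure_iff_totally_bounded\<close>).  The balls of a quasi-norm need not be open, and
  the quasi-norm need not come from a metric, but by the quasi-triangle inequality they are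
  still neighbourhoods of their centres, and the usual argument by nested sets goes through.
\<close>

section \<open>Coverings by balls\<close>

text \<open>
  Since the centres form a set of at most \<open>k\<close> points, combining two coverings amounts to
  bounding the cardinality of an image of a product.
\<close>

definition covered_by_balls :: "('b::ab_group_add \<Rightarrow> real) \<Rightarrow> nat \<Rightarrow> real \<Rightarrow> 'b set \<Rightarrow> bool" where
  "covered_by_balls N k \<epsilon> A \<longleftrightarrow>
    (\<exists>F. finite F \<and> card F \<le> k \<and> (\<forall>x\<in>A. \<exists>c\<in>F. N (x - c) \<le> \<epsilon>))"

lemma covered_by_ballsE:
  assumes "covered_by_balls N k \<epsilon> A"
  obtains F where "finite F" "card F \<le> k" "\<And>x. x \<in> A \<Longrightarrow> \<exists>c\<in>F. N (x - c) \<le> \<epsilon>"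
  using assms unfolding covered_by_balls_def by blast

lemma covered_by_balls_mono:
  assumes "covered_by_balls N k \<epsilon> A" "k \<le> l" "\<epsilon> \<le> \<delta>" "B \<subseteq> A"
  shows "covered_by_balls N l \<delta> B"
  using assms unfolding covered_by_balls_def by (meson order_trans subsetD)

text \<open>
  The common core of sums and compositions: if a point of \<open>D\<close> is controlled by a point of \<open>A\<close> and,
  once a centre \<open>c\<close> near the latter has been chosen, by a point of \<open>B\<close>, then the points \<open>h c d\<close>
  formed from pairs of centres serve as centres for \<open>D\<close>.  The point of \<open>B\<close> may depend on \<open>c\<close>,
  which compositions require.
\<close>

lemma covered_by_balls_prod:
  assumes "covered_by_balls M k \<epsilon> A" "covered_by_balls N l \<delta> B"
    and "\<And>x. x \<in> D \<Longrightarrow> \<exists>a\<in>A. \<forall>c. M (a - c) \<le> \<epsilon> \<longrightarrow>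
           (\<exists>b\<in>B. \<forall>d. N (b - d) \<le> \<delta> \<longrightarrow> P (x - h c d) \<le> r)"
  shows "covered_by_balls P (k * l) r D"
proof -
  obtain F where F: "finite F" "card F \<le> k" "\<And>x. x \<in> A \<Longrightarrow> \<exists>c\<in>F. M (x - c) \<le> \<epsilon>"
    using assms(1) by (rule covered_by_ballsE) blast
  obtain G where G: "finite G" "card G \<le> l" "\<And>x. x \<in> B \<Longrightarrow> \<exists>c\<in>G. N (x - c) \<le> \<delta>"
    using assms(2) by (rule covered_by_ballsE) blast
  let ?H = "(\<lambda>(c, d). h c d) ` (F \<times> G)"
  have "card ?H \<le> card (F \<times> G)"
    using F G by (intro card_image_le) auto
  also have "\<dots> \<le> k * l"
    using F G by (simp add: card_cartesian_product mult_le_mono)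
  finally have "card ?H \<le> k * l" .
  moreover have "\<exists>e\<in>?H. P (x - e) \<le> r" if "x \<in> D" for x
  proof -
    obtain a where a: "a \<in> A" and ac: "\<And>c. M (a - c) \<le> \<epsilon> \<Longrightarrow>
        \<exists>b\<in>B. \<forall>d. N (b - d) \<le> \<delta> \<longrightarrow> P (x - h c d) \<le> r"
      using assms(3)[OF \<open>x \<in> D\<close>] by blast
    obtain c where c: "c \<in> F" "M (a - c) \<le> \<epsilon>"
      using F(3)[OF a] by blast
    obtain b where b: "b \<in> B" and bd: "\<And>d. N (b - d) \<le> \<delta> \<Longrightarrow> P (x - h c d) \<le> r"
      using ac[OF c(2)] by blast
    obtain d where d: "d \<in> G" "N (b - d) \<le> \<delta>"
      using G(3)[OF b] by blast
    show ?thesis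
      using bd[OF d(2)] c(1) d(1) by force
  qed
  ultimately show ?thesis
    unfolding covered_by_balls_def using F G by (intro exI[of _ ?H]) auto
qed

lemma covered_by_balls_add:
  assumes "covered_by_balls N k \<epsilon> (S ` U)" "covered_by_balls N l \<delta> (T ` U)"
    and add: "\<And>u v. N u \<le> \<epsilon> \<Longrightarrow> N v \<le> \<delta> \<Longrightarrow> N (u + v) \<le> r"
  shows "covered_by_balls N (k * l) r ((\<lambda>x. S x + T x) ` U)"
proof (rule covered_by_balls_prod[OF assms(1,2), where h = "(+)"])
  fix z assume "z \<in> (\<lambda>x. S x + T x) ` U"
  then obtain x where x: "x \<in> U" "z = S x + T x" by blast
  have "N (z - (c + d)) \<le> r" if "N (S x - c) \<le> \<epsilon>" "N (T x - d) \<le> \<delta>" for c d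
    using add[OF that] x(2) by (simp add: algebra_simps)
  then show "\<exists>a\<in>S ` U. \<forall>c. N (a - c) \<le> \<epsilon> \<longrightarrow>
      (\<exists>b\<in>T ` U. \<forall>d. N (b - d) \<le> \<delta> \<longrightarrow> N (z - (c + d)) \<le> r)"
    using x(1) by blast
qed

context quasi_norm
begin

lemma norm_minus: "N (- x) = N x"
  using homogeneous[of "-1" x] by simp

lemma norm_zero: "N 0 = 0"
  by (simp add: eq_0_iff)

lemma diff_commute: "N (x - y) = N (y - x)"
  using norm_minus[of "x - y"] by simp

lemma const_pos: "C > 0"
  using const_ge_1 by simp

lemma diff_triangle: "N (x - z) \<le> C * (N (x - y) + N (y - z))"
  using quasi_triangle[of "x - y" "y - z"] by simp

lemma diff_triangle_le:
  assumes "N (x - y) \<le> a" "N (y - z) \<le> b"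
  shows "N (x - z) \<le> C * (a + b)"
proof -
  have "C * (N (x - y) + N (y - z)) \<le> C * (a + b)"
    using assms const_pos by (intro mult_left_mono) auto
  with diff_triangle[of x z y] show ?thesis by linarith
qed

lemma norm_scale_of_real: "r \<ge> 0 \<Longrightarrow> N (scale (of_real r) x) = r * N x"
  by (simp add: homogeneous)

lemma mem_translated_ball:
  assumes "\<epsilon> > 0"
  shows "u \<in> (\<lambda>z. y + scale (of_real \<epsilon>) z) ` unit_ball N \<longleftrightarrow> N (u - y) \<le> \<epsilon>"
proof
  assume "u \<in> (\<lambda>z. y + scale (of_real \<epsilon>) z) ` unit_ball N"
  then obtain z where "u = y + scale (of_real \<epsilon>) z" "N z \<le> 1"
    by (auto simp: unit_ball_def)
  then show "N (u - y) \<le> \<epsilon>"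
    using assms by (simp add: norm_scale_of_real)
next
  assume le: "N (u - y) \<le> \<epsilon>"
  let ?z = "scale (of_real (1 / \<epsilon>)) (u - y)"
  have "scale (of_real \<epsilon>) ?z = scale (of_real (\<epsilon> * (1 / \<epsilon>))) (u - y)"
    by (simp only: scale_scale of_real_mult)
  then have "u = y + scale (of_real \<epsilon>) ?z"
    using assms by simp
  moreover have "N ?z = 1 / \<epsilon> * N (u - y)"
    using assms by (intro norm_scale_of_real) simp
  then have "?z \<in> unit_ball N"
    using le assms by (simp add: unit_ball_def)
  ultimately show "u \<in> (\<lambda>z. y + scale (of_real \<epsilon>) z) ` unit_ball N"
    by (rule image_eqI)
qed

lemma covered_by_balls_iff_indexed:
  assumes "\<epsilon> > 0"
  shows "covered_by_balls N k \<epsilon> A \<longleftrightarrow>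
    (\<exists>y :: nat \<Rightarrow> 'a. A \<subseteq> (\<Union>i\<in>{1..k}. (\<lambda>z. y i + scale (of_real \<epsilon>) z) ` unit_ball N))"
proof
  assume "covered_by_balls N k \<epsilon> A"
  then obtain F where F: "finite F" "card F \<le> k" "\<And>x. x \<in> A \<Longrightarrow> \<exists>c\<in>F. N (x - c) \<le> \<epsilon>"
    by (rule covered_by_ballsE) blast
  obtain y :: "nat \<Rightarrow> 'a" where "bij_betw y {1..card F} F"
    using ex_bij_betw_nat_finite_1[OF F(1)] by blast
  then have "F = y ` {1..card F}"
    by (simp add: bij_betw_def)
  also have "\<dots> \<subseteq> y ` {1..k}"
    using F(2) by (intro image_mono) auto
  finally have "F \<subseteq> y ` {1..k}" .
  then have "\<exists>i\<in>{1..k}. N (x - y i) \<le> \<epsilon>" if "x \<in> A" for x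
    using F(3)[OF that] by blast
  then show "\<exists>y :: nat \<Rightarrow> 'a. A \<subseteq> (\<Union>i\<in>{1..k}. (\<lambda>z. y i + scale (of_real \<epsilon>) z) ` unit_ball N)"
    by (intro exI[of _ y] subsetI) (simp only: UN_iff mem_translated_ball[OF assms])
next
  assume "\<exists>y :: nat \<Rightarrow> 'a. A \<subseteq> (\<Union>i\<in>{1..k}. (\<lambda>z. y i + scale (of_real \<epsilon>) z) ` unit_ball N)"
  then obtain y :: "nat \<Rightarrow> 'a"
    where y: "A \<subseteq> (\<Union>i\<in>{1..k}. (\<lambda>z. y i + scale (of_real \<epsilon>) z) ` unit_ball N)" ..
  then have "\<exists>i\<in>{1..k}. N (x - y i) \<le> \<epsilon>" if "x \<in> A" for x
    using subsetD[OF y that] by (simp only: UN_iff mem_translated_ball[OF assms])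
  moreover have "card (y ` {1..k}) \<le> k"
    using card_image_le[of "{1..k}" y] by simp
  ultimately show "covered_by_balls N k \<epsilon> A"
    unfolding covered_by_balls_def by (intro exI[of _ "y ` {1..k}"]) auto
qed

end

text \<open>
  A point \<open>T x\<close> in the ball of radius \<open>\<epsilon>\<close> around \<open>c\<close> is \<open>c + \<epsilon> v\<close> with \<open>v\<close> in the unit ball, and
  a covering of the image of the unit ball under \<open>S\<close> takes care of \<open>S v\<close>: the centres of the new
  covering are \<open>S c + \<epsilon> d\<close>.
\<close>

lemma covered_by_balls_compose:
  assumes Y: "quasi_norm sY NY CY" and W: "quasi_norm sW NW CW"
    and S: "Vector_Spaces.linear sY sW S" and "\<epsilon> > 0"
    and "covered_by_balls NW k \<delta> (S ` unit_ball NY)" "covered_by_balls NY l \<epsilon> A"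
  shows "covered_by_balls NW (k * l) (\<delta> * \<epsilon>) (S ` A)"
proof -
  interpret Y: quasi_norm sY NY CY by fact
  interpret W: quasi_norm sW NW CW by fact
  interpret S: Vector_Spaces.linear sY sW S by fact
  have "covered_by_balls NW (l * k) (\<delta> * \<epsilon>) (S ` A)"
  proof (rule covered_by_balls_prod[OF assms(6,5),
        where h = "\<lambda>c d. S c + sW (of_real \<epsilon>) d"])
    fix z assume "z \<in> S ` A"
    then obtain x where x: "x \<in> A" "z = S x" by blast
    have "\<exists>b\<in>S ` unit_ball NY. \<forall>d. NW (b - d) \<le> \<delta> \<longrightarrow>
        NW (z - (S c + sW (of_real \<epsilon>) d)) \<le> \<delta> * \<epsilon>" if c: "NY (x - c) \<le> \<epsilon>" for c
    proof -
      obtain v where v: "x = c + sY (of_real \<epsilon>) v" "v \<in> unit_ball NY"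
        using iffD2[OF Y.mem_translated_ball[OF \<open>\<epsilon> > 0\<close>] c] by (rule imageE)
      have "NW (z - (S c + sW (of_real \<epsilon>) d)) \<le> \<delta> * \<epsilon>" if "NW (S v - d) \<le> \<delta>" for d
      proof -
        have "z - (S c + sW (of_real \<epsilon>) d) = sW (of_real \<epsilon>) (S v - d)"
          by (simp add: x v(1) S.add S.scale W.scale_right_diff_distrib)
        then show ?thesis
          using that \<open>\<epsilon> > 0\<close> by (simp add: W.norm_scale_of_real mult.commute)
      qed
      then show ?thesis using v(2) by blast
    qed
    then show "\<exists>a\<in>A. \<forall>c. NY (a - c) \<le> \<epsilon> \<longrightarrow> (\<exists>b\<in>S ` unit_ball NY. \<forall>d. NW (b - d) \<le> \<delta> \<longrightarrow>
        NW (z - (S c + sW (of_real \<epsilon>) d)) \<le> \<delta> * \<epsilon>)"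
      using x(1) by blast
  qed
  then show ?thesis by (simp add: mult.commute)
qed

section \<open>Entropy numbers and the operator norm\<close>

lemma bounded_on_unit_ball:
  assumes "\<exists>K. \<forall>x. N (T x) \<le> K * M x" "\<And>x. 0 \<le> M x"
  shows "\<exists>K. \<forall>x\<in>unit_ball M. N (T x) \<le> K"
proof -
  obtain K where K: "\<And>x. N (T x) \<le> K * M x" using assms(1) by blast
  have "N (T x) \<le> \<bar>K\<bar>" if "M x \<le> 1" for x
  proof -
    have "K * M x \<le> \<bar>K\<bar> * 1"
      using that assms(2) by (intro mult_mono) auto
    with K[of x] show ?thesis by simp
  qed
  then show ?thesis by (auto simp: unit_ball_def)
qed

context quasi_norm
begin

lemma entropy_number_eq:
  "entropy_number NX scale N n T =
    Inf {\<epsilon>. \<epsilon> > 0 \<and> covered_by_balls N (2 ^ (n - 1)) \<epsilon> (T ` unit_ball NX)}"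
  unfolding entropy_number_def
  by (intro arg_cong[of _ _ Inf] Collect_cong conj_cong refl)
     (rule covered_by_balls_iff_indexed[symmetric])

lemma entropy_number_le:
  assumes "\<epsilon> > 0" "covered_by_balls N (2 ^ (n - 1)) \<epsilon> (T ` unit_ball NX)"
  shows "entropy_number NX scale N n T \<le> \<epsilon>"
  unfolding entropy_number_eq using assms
  by (intro cInf_lower) (auto intro!: bdd_belowI[of _ 0])

lemma covered_by_balls_bounded:
  assumes "\<And>x. x \<in> A \<Longrightarrow> N x \<le> K" "k > 0"
  shows "covered_by_balls N k K A"
  unfolding covered_by_balls_def using assms by (intro exI[of _ "{0}"]) auto

text \<open>
  Boundedness provides one admissible radius; without it the infimum would be taken over the
  empty set.
\<close>

lemma entropy_radii_nonempty:
  assumes "\<And>x. x \<in> unit_ball NX \<Longrightarrow> N (T x) \<le> K"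
  shows "{\<epsilon>. \<epsilon> > 0 \<and> covered_by_balls N (2 ^ (n - 1)) \<epsilon> (T ` unit_ball NX)} \<noteq> {}"
proof -
  have "covered_by_balls N (2 ^ (n - 1)) (max K 1) (T ` unit_ball NX)"
    using assms by (intro covered_by_balls_bounded) (auto simp: le_max_iff_disj)
  then show ?thesis
    by (auto intro!: exI[of _ "max K 1"])
qed

lemma entropy_number_nonneg:
  assumes "\<And>x. x \<in> unit_ball NX \<Longrightarrow> N (T x) \<le> K"
  shows "entropy_number NX scale N n T \<ge> 0"
  unfolding entropy_number_eq using entropy_radii_nonempty[OF assms]
  by (intro cInf_greatest) auto

text \<open>
  The admissible radii are upward closed, so every radius above the infimum is admissible.
\<close>

lemma covered_by_balls_if_entropy_number_less:
  assumes "\<And>x. x \<in> unit_ball NX \<Longrightarrow> N (T x) \<le> K" and "entropy_number NX scale N n T < r"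
  shows "covered_by_balls N (2 ^ (n - 1)) r (T ` unit_ball NX)"
proof -
  obtain \<epsilon> where "covered_by_balls N (2 ^ (n - 1)) \<epsilon> (T ` unit_ball NX)" "\<epsilon> < r"
    using cInf_lessD[OF entropy_radii_nonempty[where T = T, OF assms(1), where n = n]] assms(2)
    unfolding entropy_number_eq by blast
  then show ?thesis
    by (rule covered_by_balls_mono[OF _ order_refl less_imp_le subset_refl])
qed

lemma entropy_number_antimono:
  assumes "\<And>x. x \<in> unit_ball NX \<Longrightarrow> N (T x) \<le> K" and "m \<le> n"
  shows "entropy_number NX scale N n T \<le> entropy_number NX scale N m T"
proof (rule dense_ge)
  fix r assume r: "entropy_number NX scale N m T < r"
  then have "covered_by_balls N (2 ^ (m - 1)) r (T ` unit_ball NX)"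
    using assms(1) by (intro covered_by_balls_if_entropy_number_less)
  moreover have "(2::nat) ^ (m - 1) \<le> 2 ^ (n - 1)"
    using assms(2) by (intro power_increasing) auto
  ultimately have "covered_by_balls N (2 ^ (n - 1)) r (T ` unit_ball NX)"
    by (rule covered_by_balls_mono[OF _ _ order_refl subset_refl])
  moreover have "r > 0"
    using r entropy_number_nonneg[where NX = NX and T = T, OF assms(1), where n = m] by linarith
  ultimately show "entropy_number NX scale N n T \<le> r"
    by (rule entropy_number_le[rotated])
qed

lemma operator_norm_bound:
  assumes "\<And>x. x \<in> unit_ball NX \<Longrightarrow> N (T x) \<le> K" and "x \<in> unit_ball NX"
  shows "N (T x) \<le> operator_norm NX N T"
  unfolding operator_norm_def using assms
  by (intro cSUP_upper) (auto intro!: bdd_aboveI[of _ K])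

lemma entropy_number_le_operator_norm:
  assumes "\<And>x. x \<in> unit_ball NX \<Longrightarrow> N (T x) \<le> K" and "unit_ball NX \<noteq> {}"
  shows "entropy_number NX scale N n T \<le> operator_norm NX N T"
proof (rule dense_ge)
  fix r assume r: "operator_norm NX N T < r"
  have le: "N (T x) \<le> r" if "x \<in> unit_ball NX" for x
    using operator_norm_bound[where T = T, OF assms(1) that] r by linarith
  then have "covered_by_balls N (2 ^ (n - 1)) r (T ` unit_ball NX)"
    by (intro covered_by_balls_bounded) auto
  moreover have "r > 0"
  proof -
    obtain x where "x \<in> unit_ball NX" using assms(2) by blast
    then have "N (T x) < r"
      using operator_norm_bound[where T = T, OF assms(1)] r by fastforce
    with nonneg[of "T x"] show ?thesis by linarith
  qed
  ultimately show "entropy_number NX scale N n T \<le> r"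
    by (rule entropy_number_le[rotated])
qed

text \<open>
  A symmetric set inside a ball around an arbitrary centre lies, up to the factor \<open>C\<close>, in the
  ball of the same radius around the origin.
\<close>

lemma norm_le_if_symmetric_in_ball:
  assumes "N (u - c) \<le> r" "N (- u - c) \<le> r"
  shows "N u \<le> C * r"
proof -
  have "N (u - - u) \<le> C * (r + r)"
    using assms diff_commute[of c "- u"] by (intro diff_triangle_le[of u c]) simp_all
  moreover have "u - - u = scale (of_real 2) u"
    using scale_left_distrib[of 1 1 u] by simp
  then have "N (u - - u) = 2 * N u"
    using norm_scale_of_real[of 2 u] by simp
  ultimately show ?thesis by simp
qed

lemma operator_norm_le_entropy_number:
  assumes "\<And>x. x \<in> unit_ball NX \<Longrightarrow> N (T x) \<le> K" and "unit_ball NX \<noteq> {}"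
    and sym: "\<And>x. x \<in> unit_ball NX \<Longrightarrow> - T x \<in> T ` unit_ball NX"
  shows "operator_norm NX N T \<le> C * entropy_number NX scale N 1 T"
proof -
  have "N (T x) \<le> C * entropy_number NX scale N 1 T" if x: "x \<in> unit_ball NX" for x
  proof -
    have "N (T x) / C \<le> r" if "entropy_number NX scale N 1 T < r" for r
    proof -
      have "covered_by_balls N (2 ^ (1 - 1)) r (T ` unit_ball NX)"
        using assms(1) that by (intro covered_by_balls_if_entropy_number_less)
      then obtain F where F: "finite F" "card F \<le> 2 ^ (1 - 1)"
        "\<And>y. y \<in> T ` unit_ball NX \<Longrightarrow> \<exists>c\<in>F. N (y - c) \<le> r"
        by (rule covered_by_ballsE) blast
      obtain c where c: "c \<in> F" "N (T x - c) \<le> r" using F(3) x by blast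
      obtain d where d: "d \<in> F" "N (- T x - d) \<le> r" using F(3) sym[OF x] by blast
      \<comment> \<open>There is only one ball.\<close>
      have "d = c"
        using F(1,2) c(1) d(1) by (auto simp: card_le_Suc0_iff_eq)
      then have "N (T x) \<le> C * r"
        using c(2) d(2) by (intro norm_le_if_symmetric_in_ball[of _ c]) auto
      then show ?thesis
        using const_pos by (simp add: field_simps)
    qed
    then have "N (T x) / C \<le> entropy_number NX scale N 1 T" by (rule dense_ge)
    then show ?thesis
      using const_pos by (simp add: field_simps)
  qed
  then show ?thesis
    unfolding operator_norm_def using assms(2) by (intro cSUP_least)
qed

text \<open>
  The function \<open>R\<close> gives the radius of a ball that contains the sum of two balls of radii
  \<open>r\<close> and \<open>s\<close>, so that the statement applies to quasi-norms and to \<open>\<rho>\<close>-norms alike.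
\<close>

lemma entropy_number_add:
  assumes "\<And>x. x \<in> unit_ball NX \<Longrightarrow> N (S x) \<le> K" "\<And>x. x \<in> unit_ball NX \<Longrightarrow> N (T x) \<le> L"
    and "m \<ge> 1" "n \<ge> 1"
    and R: "\<And>r s u v. r > 0 \<Longrightarrow> s > 0 \<Longrightarrow> N u \<le> r \<Longrightarrow> N v \<le> s \<Longrightarrow> N (u + v) \<le> R r s"
    and R_pos: "\<And>r s. r > 0 \<Longrightarrow> s > 0 \<Longrightarrow> R r s > 0"
    and less: "entropy_number NX scale N m S < r" "entropy_number NX scale N n T < s"
  shows "entropy_number NX scale N (m + n - 1) (\<lambda>x. S x + T x) \<le> R r s"
proof -
  have r: "r > 0" and s: "s > 0"
    using less entropy_number_nonneg[where NX = NX and T = S, OF assms(1), where n = m]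
      entropy_number_nonneg[where NX = NX and T = T, OF assms(2), where n = n] by linarith+
  have "covered_by_balls N (2 ^ (m - 1) * 2 ^ (n - 1)) (R r s) ((\<lambda>x. S x + T x) ` unit_ball NX)"
  proof (rule covered_by_balls_add)
    show "covered_by_balls N (2 ^ (m - 1)) r (S ` unit_ball NX)"
      using assms(1) less(1) by (rule covered_by_balls_if_entropy_number_less)
    show "covered_by_balls N (2 ^ (n - 1)) s (T ` unit_ball NX)"
      using assms(2) less(2) by (rule covered_by_balls_if_entropy_number_less)
  qed (rule R[OF r s])
  moreover have "(2::nat) ^ (m - 1) * 2 ^ (n - 1) = 2 ^ (m + n - 1 - 1)"
    using \<open>m \<ge> 1\<close> \<open>n \<ge> 1\<close> by (simp add: power_add[symmetric])
  ultimately show ?thesis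
    using R_pos[OF r s] by (intro entropy_number_le) auto
qed

end

section \<open>Additivity and multiplicativity\<close>

lemma le_if_le_at_right_limit:
  fixes f :: "real \<Rightarrow> real"
  assumes "(f \<longlongrightarrow> l) (at_right 0)" "\<And>d. d > 0 \<Longrightarrow> a \<le> f d"
  shows "a \<le> l"
proof (rule tendsto_lowerbound[OF assms(1)])
  show "eventually (\<lambda>d. a \<le> f d) (at_right 0)"
    using eventually_at_right_less[of "0::real"] by (rule eventually_mono) (rule assms(2))
qed simp

lemma (in quasi_norm) entropy_number_add_le:
  assumes "\<And>x. x \<in> unit_ball NX \<Longrightarrow> N (S x) \<le> K" "\<And>x. x \<in> unit_ball NX \<Longrightarrow> N (T x) \<le> L"
    and "m \<ge> 1" "n \<ge> 1"
  shows "entropy_number NX scale N (m + n - 1) (\<lambda>x. S x + T x)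
    \<le> C * (entropy_number NX scale N m S + entropy_number NX scale N n T)"
proof (rule le_if_le_at_right_limit)
  let ?a = "entropy_number NX scale N m S" and ?b = "entropy_number NX scale N n T"
  show "((\<lambda>d. C * ((?a + d) + (?b + d))) \<longlongrightarrow> C * (?a + ?b)) (at_right 0)"
    by (auto intro!: tendsto_eq_intros)
  fix d :: real assume "d > 0"
  show "entropy_number NX scale N (m + n - 1) (\<lambda>x. S x + T x) \<le> C * ((?a + d) + (?b + d))"
  proof (rule entropy_number_add[where R = "\<lambda>r s. C * (r + s)", OF assms])
    fix r s u v assume "N u \<le> r" "N v \<le> s"
    then show "N (u + v) \<le> C * (r + s)"
      using diff_triangle_le[of u 0 r "- v" s] by simp
  qed (use \<open>d > 0\<close> const_pos in auto)
qed

text \<open>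
  The constant \<open>2 powr (1 / \<rho>)\<close> is not optimal; its only purpose is to make the results on
  quasi-norms available for \<open>\<rho>\<close>-norms.
\<close>

lemma (in rho_norm) quasi_norm: "quasi_norm scale N (2 powr (1 / \<rho>))"
proof unfold_locales
  show "1 \<le> 2 powr (1 / \<rho>)"
    using rho_pos by (intro ge_one_powr_ge_zero) auto
  fix x y :: 'a and c :: 'k
  show "0 \<le> N x" "N x = 0 \<longleftrightarrow> x = 0" "N (scale c x) = norm c * N x"
    by (rule nonneg eq_0_iff homogeneous)+
  let ?M = "max (N x) (N y)"
  have "N (x + y) powr \<rho> \<le> N x powr \<rho> + N y powr \<rho>"
    by (rule rho_triangle)
  also have "\<dots> \<le> ?M powr \<rho> + ?M powr \<rho>"
    using rho_pos nonneg by (intro add_mono powr_mono2) auto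
  finally have "(N (x + y) powr \<rho>) powr (1 / \<rho>) \<le> (2 * ?M powr \<rho>) powr (1 / \<rho>)"
    using rho_pos by (intro powr_mono2) auto
  also have "\<dots> = 2 powr (1 / \<rho>) * ?M"
    using rho_pos nonneg[of x] by (simp add: powr_mult powr_powr)
  also have "\<dots> \<le> 2 powr (1 / \<rho>) * (N x + N y)"
    using nonneg[of x] nonneg[of y] by (intro mult_left_mono) auto
  finally show "N (x + y) \<le> 2 powr (1 / \<rho>) * (N x + N y)"
    using rho_pos nonneg[of "x + y"] by (simp add: powr_powr)
qed

lemma (in rho_norm) entropy_number_add_powr_le:
  assumes S: "\<And>x. x \<in> unit_ball NX \<Longrightarrow> N (S x) \<le> K"
    and T: "\<And>x. x \<in> unit_ball NX \<Longrightarrow> N (T x) \<le> L"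
    and "m \<ge> 1" "n \<ge> 1"
  shows "entropy_number NX scale N (m + n - 1) (\<lambda>x. S x + T x) powr \<rho>
    \<le> entropy_number NX scale N m S powr \<rho> + entropy_number NX scale N n T powr \<rho>"
proof -
  interpret Q: quasi_norm scale N "2 powr (1 / \<rho>)" by (rule quasi_norm)
  let ?a = "entropy_number NX scale N m S" and ?b = "entropy_number NX scale N n T"
  let ?e = "entropy_number NX scale N (m + n - 1) (\<lambda>x. S x + T x)"
  have a: "?a \<ge> 0" and b: "?b \<ge> 0"
    using Q.entropy_number_nonneg[where NX = NX and T = S, OF S]
      Q.entropy_number_nonneg[where NX = NX and T = T, OF T]
    by auto
  have "N (S x + T x) \<le> 2 powr (1 / \<rho>) * (K + L)" if "x \<in> unit_ball NX" for x
    using Q.diff_triangle_le[of "S x" 0 K "- T x" L] S[OF that] T[OF that] by simp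
  then have e: "?e \<ge> 0"
    by (rule Q.entropy_number_nonneg)
  define R where "R r s = (r powr \<rho> + s powr \<rho>) powr (1 / \<rho>)" for r s
  have "?e powr \<rho> \<le> (?a + d) powr \<rho> + (?b + d) powr \<rho>" if "d > 0" for d
  proof -
    have "?e \<le> R (?a + d) (?b + d)"
    proof (rule Q.entropy_number_add[where R = R, OF assms])
      fix r s :: real assume rs: "r > 0" "s > 0"
      then have "r powr \<rho> > 0" by simp
      then show "R r s > 0"
        unfolding R_def by (smt (verit) powr_ge_zero powr_gt_zero)
      fix u v assume "N u \<le> r" "N v \<le> s"
      then have "N u powr \<rho> \<le> r powr \<rho>" "N v powr \<rho> \<le> s powr \<rho>"
        using rho_pos nonneg by (auto intro: powr_mono2)
      then have "N (u + v) powr \<rho> \<le> r powr \<rho> + s powr \<rho>"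
        using rho_triangle[of u v] by linarith
      then have "(N (u + v) powr \<rho>) powr (1 / \<rho>) \<le> R r s"
        unfolding R_def using rho_pos by (intro powr_mono2) auto
      then show "N (u + v) \<le> R r s"
        using rho_pos nonneg[of "u + v"] by (simp add: powr_powr)
    qed (use that in auto)
    then have "?e powr \<rho> \<le> R (?a + d) (?b + d) powr \<rho>"
      using e rho_pos by (intro powr_mono2) auto
    also have "\<dots> = (?a + d) powr \<rho> + (?b + d) powr \<rho>"
      using rho_pos by (simp add: R_def powr_powr)
    finally show ?thesis .
  qed
  moreover have "((\<lambda>d. (c + d) powr \<rho>) \<longlongrightarrow> c powr \<rho>) (at_right 0)" if "c \<ge> 0" for c
  proof (rule tendsto_powr')
    show "((\<lambda>d. c + d) \<longlongrightarrow> c) (at_right 0)"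
      by (auto intro!: tendsto_eq_intros)
    \<comment> \<open>At \<open>c = 0\<close> this rests on \<open>\<rho> > 0\<close> and on approaching \<open>0\<close> from the right.\<close>
    have "eventually (\<lambda>d. 0 \<le> c + d) (at_right 0)"
      using that by (intro eventually_mono[OF eventually_at_right_less[of "0::real"]]) auto
    then show "c \<noteq> 0 \<or> (0 < \<rho> \<and> eventually (\<lambda>d. 0 \<le> c + d) (at_right 0))"
      using rho_pos by simp
  qed simp
  then have "((\<lambda>d. (?a + d) powr \<rho> + (?b + d) powr \<rho>) \<longlongrightarrow> ?a powr \<rho> + ?b powr \<rho>) (at_right 0)"
    using a b by (intro tendsto_add)
  ultimately show ?thesis
    by (rule le_if_le_at_right_limit[rotated])
qed

lemma entropy_number_compose_le:
  assumes Y: "quasi_norm sY NY CY" and W: "quasi_norm sW NW CW"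
    and S: "Vector_Spaces.linear sY sW S"
    and K: "\<And>x. x \<in> unit_ball NY \<Longrightarrow> NW (S x) \<le> K"
    and L: "\<And>x. x \<in> unit_ball NX \<Longrightarrow> NY (T x) \<le> L"
    and "m \<ge> 1" "n \<ge> 1"
  shows "entropy_number NX sW NW (m + n - 1) (\<lambda>x. S (T x))
    \<le> entropy_number NY sW NW m S * entropy_number NX sY NY n T"
proof (rule le_if_le_at_right_limit)
  interpret Y: quasi_norm sY NY CY by fact
  interpret W: quasi_norm sW NW CW by fact
  let ?a = "entropy_number NY sW NW m S" and ?b = "entropy_number NX sY NY n T"
  have a: "?a \<ge> 0" and b: "?b \<ge> 0"
    using W.entropy_number_nonneg[where NX = NY and T = S, OF K]
      Y.entropy_number_nonneg[where NX = NX and T = T, OF L]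
    by auto
  show "((\<lambda>d. (?a + d) * (?b + d)) \<longlongrightarrow> ?a * ?b) (at_right 0)"
    by (auto intro!: tendsto_eq_intros)
  fix d :: real assume d: "d > 0"
  have "covered_by_balls NW (2 ^ (m - 1)) (?a + d) (S ` unit_ball NY)"
    using d by (intro W.covered_by_balls_if_entropy_number_less[OF K]) auto
  moreover have "covered_by_balls NY (2 ^ (n - 1)) (?b + d) (T ` unit_ball NX)"
    using d by (intro Y.covered_by_balls_if_entropy_number_less[OF L]) auto
  ultimately have "covered_by_balls NW (2 ^ (m - 1) * 2 ^ (n - 1)) ((?a + d) * (?b + d))
      (S ` T ` unit_ball NX)"
    using b d by (intro covered_by_balls_compose[OF Y W S]) auto
  moreover have "(2::nat) ^ (m - 1) * 2 ^ (n - 1) = 2 ^ (m + n - 1 - 1)"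
    using \<open>m \<ge> 1\<close> \<open>n \<ge> 1\<close> by (simp add: power_add[symmetric])
  ultimately show "entropy_number NX sW NW (m + n - 1) (\<lambda>x. S (T x)) \<le> (?a + d) * (?b + d)"
    using a b d by (intro W.entropy_number_le) (auto simp: image_image)
qed

section \<open>Total boundedness and compactness\<close>

lemma topspace_qn_topology: "topspace (qn_topology N) = UNIV"
proof -
  have "openin (qn_topology N) UNIV"
    unfolding openin_qn_topology by (simp add: gt_ex)
  then show ?thesis
    using openin_subset by blast
qed

context quasi_norm
begin

text \<open>
  The points with a small ball inside the given ball form an open set: halving the radius, with
  an additional factor \<open>C\<close>, leaves room for a second step.
\<close>

lemma ball_is_neighbourhood:
  assumes "\<epsilon> > 0"
  obtains V where "openin (qn_topology N) V" "x \<in> V" "V \<subseteq> {y. N (y - x) < \<epsilon>}"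
proof
  let ?V = "{y. \<exists>\<delta>>0. \<forall>z. N (z - y) < \<delta> \<longrightarrow> N (z - x) < \<epsilon>}"
  show "openin (qn_topology N) ?V"
    unfolding openin_qn_topology
  proof
    fix y assume "y \<in> ?V"
    then obtain \<delta> where \<delta>: "\<delta> > 0" "\<And>z. N (z - y) < \<delta> \<Longrightarrow> N (z - x) < \<epsilon>" by blast
    let ?\<eta> = "\<delta> / (2 * C)"
    have \<eta>: "?\<eta> > 0" using \<delta>(1) const_pos by simp
    have "z \<in> ?V" if z: "N (z - y) < ?\<eta>" for z
    proof -
      have "N (w - x) < \<epsilon>" if w: "N (w - z) < ?\<eta>" for w
      proof (rule \<delta>(2))
        have "N (w - y) \<le> C * (N (w - z) + N (z - y))" by (rule diff_triangle)
        also have "\<dots> < C * (?\<eta> + ?\<eta>)"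
          using z w const_pos by (intro mult_strict_left_mono add_strict_mono)
        also have "\<dots> = \<delta>" using const_pos by (simp add: field_simps)
        finally show "N (w - y) < \<delta>" .
      qed
      then show ?thesis using \<eta> by blast
    qed
    then show "\<exists>\<eta>>0. \<forall>z. N (z - y) < \<eta> \<longrightarrow> z \<in> ?V"
      using \<eta> by blast
  qed
  show "x \<in> ?V" using assms by blast
  show "?V \<subseteq> {y. N (y - x) < \<epsilon>}"
  proof
    fix y assume "y \<in> ?V"
    then obtain \<delta> where "\<delta> > 0" "\<forall>z. N (z - y) < \<delta> \<longrightarrow> N (z - x) < \<epsilon>" by blast
    then show "y \<in> {y. N (y - x) < \<epsilon>}"
      by (simp add: norm_zero)
  qed
qed

lemma covered_by_balls_if_compactin:
  assumes "compactin (qn_topology N) K" "\<epsilon> > 0"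
  shows "\<exists>k. covered_by_balls N k \<epsilon> K"
proof -
  have "\<forall>x. \<exists>V. openin (qn_topology N) V \<and> x \<in> V \<and> V \<subseteq> {y. N (y - x) < \<epsilon>}"
    using ball_is_neighbourhood[OF assms(2)] by metis
  then obtain V where V: "\<And>x. openin (qn_topology N) (V x)" "\<And>x. x \<in> V x"
      "\<And>x. V x \<subseteq> {y. N (y - x) < \<epsilon>}"
    by metis
  have "\<exists>\<F>. finite \<F> \<and> \<F> \<subseteq> range V \<and> K \<subseteq> \<Union>\<F>"
    using V(1,2) by (intro compactinD[OF assms(1)]) auto
  then obtain F where F: "finite F" "K \<subseteq> \<Union>(V ` F)"
    by (metis finite_subset_image)
  have "\<exists>c\<in>F. N (x - c) \<le> \<epsilon>" if "x \<in> K" for x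
    using F(2) V(3) that by (fastforce dest: less_imp_le)
  then show ?thesis
    unfolding covered_by_balls_def using F(1) by blast
qed

text \<open>
  Every point of the closure is \<open>\<epsilon>\<close>-close to the set, hence \<open>2 C \<epsilon>\<close>-close to one of the centres.
\<close>

lemma covered_by_balls_closure:
  assumes "covered_by_balls N k \<epsilon> A" "\<epsilon> > 0"
  shows "covered_by_balls N k (C * (\<epsilon> + \<epsilon>)) (qn_topology N closure_of A)"
proof -
  obtain F where F: "finite F" "card F \<le> k" "\<And>x. x \<in> A \<Longrightarrow> \<exists>c\<in>F. N (x - c) \<le> \<epsilon>"
    using assms(1) by (rule covered_by_ballsE) blast
  have "\<exists>c\<in>F. N (x - c) \<le> C * (\<epsilon> + \<epsilon>)" if x: "x \<in> qn_topology N closure_of A" for x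
  proof -
    obtain V where V: "openin (qn_topology N) V" "x \<in> V" "V \<subseteq> {y. N (y - x) < \<epsilon>}"
      using ball_is_neighbourhood[OF assms(2)] .
    then obtain y where y: "y \<in> A" "N (y - x) < \<epsilon>"
      using x unfolding in_closure_of by blast
    obtain c where c: "c \<in> F" "N (y - c) \<le> \<epsilon>" using F(3)[OF y(1)] by blast
    have "N (x - c) \<le> C * (\<epsilon> + \<epsilon>)"
      using y(2) c(2) by (intro diff_triangle_le[of x y]) (simp_all add: diff_commute[of x])
    with c(1) show ?thesis by blast
  qed
  then show ?thesis
    unfolding covered_by_balls_def using F(1,2) by blast
qed

end

text \<open>
  If an open cover of \<open>K\<close> had no finite subcover, then neither would one of the finitely many
  small pieces of \<open>K\<close>.  Iterating this yields a decreasing sequence of pieces whose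
  diameters tend to \<open>0\<close>; points chosen from them converge to a point of \<open>K\<close>, and a
  single member of the cover around this limit contains one of the pieces.
\<close>

lemma (in quasi_banach) compactin_if_closed_totally_bounded:
  assumes closed: "closedin (qn_topology N) K"
    and tb: "\<And>\<epsilon>. \<epsilon> > 0 \<Longrightarrow> \<exists>k. covered_by_balls N k \<epsilon> K"
  shows "compactin (qn_topology N) K"
  unfolding compactin_def
proof (intro conjI allI impI)
  show "K \<subseteq> topspace (qn_topology N)" by (simp add: topspace_qn_topology)
  fix \<U> assume \<U>: "Ball \<U> (openin (qn_topology N)) \<and> K \<subseteq> \<Union>\<U>"
  define finitely_covered where
    "finitely_covered S \<longleftrightarrow> (\<exists>\<D>. finite \<D> \<and> \<D> \<subseteq> \<U> \<and> S \<subseteq> \<Union>\<D>)" for S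
  show "\<exists>\<F>. finite \<F> \<and> \<F> \<subseteq> \<U> \<and> K \<subseteq> \<Union>\<F>"
  proof (rule ccontr)
    assume "\<not> (\<exists>\<F>. finite \<F> \<and> \<F> \<subseteq> \<U> \<and> K \<subseteq> \<Union>\<F>)"
    then have K: "\<not> finitely_covered K" by (simp add: finitely_covered_def)
    have step: "\<exists>S'. S' \<subseteq> S \<and> \<not> finitely_covered S' \<and> (\<exists>c. \<forall>x\<in>S'. N (x - c) \<le> \<epsilon>)"
      if S: "S \<subseteq> K" "\<not> finitely_covered S" and "\<epsilon> > 0" for S \<epsilon>
    proof (rule ccontr)
      assume contra: "\<not> (\<exists>S'. S' \<subseteq> S \<and> \<not> finitely_covered S' \<and> (\<exists>c. \<forall>x\<in>S'. N (x - c) \<le> \<epsilon>))"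
      obtain k where "covered_by_balls N k \<epsilon> K" using tb[OF \<open>\<epsilon> > 0\<close>] by blast
      then obtain F where F: "finite F" "\<And>x. x \<in> K \<Longrightarrow> \<exists>c\<in>F. N (x - c) \<le> \<epsilon>"
        by (rule covered_by_ballsE) blast
      have piece: "finitely_covered S'" if "S' \<subseteq> S" "\<forall>x\<in>S'. N (x - c) \<le> \<epsilon>" for S' c
        using contra that by metis
      have "finitely_covered {x \<in> S. N (x - c) \<le> \<epsilon>}" for c
        by (rule piece[of _ c]) auto
      then obtain \<D> where \<D>: "\<And>c. finite (\<D> c)" "\<And>c. \<D> c \<subseteq> \<U>"
          "\<And>c. {x \<in> S. N (x - c) \<le> \<epsilon>} \<subseteq> \<Union>(\<D> c)"
        unfolding finitely_covered_def by metis
      have "S \<subseteq> \<Union>(\<Union>c\<in>F. \<D> c)"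
      proof
        fix x assume "x \<in> S"
        then obtain c where "c \<in> F" "N (x - c) \<le> \<epsilon>" using F(2) S(1) by blast
        then show "x \<in> \<Union>(\<Union>c\<in>F. \<D> c)" using \<D>(3)[of c] \<open>x \<in> S\<close> by blast
      qed
      then have "finitely_covered S"
        unfolding finitely_covered_def using F(1) \<D>(1,2)
        by (intro exI[of _ "\<Union>c\<in>F. \<D> c"]) auto
      with S(2) show False by blast
    qed
    define P where "P n S \<longleftrightarrow> S \<subseteq> K \<and> \<not> finitely_covered S \<and>
      (\<exists>c. \<forall>x\<in>S. N (x - c) \<le> inverse (real (Suc n)))" for n :: nat and S
    have "\<exists>S. P 0 S"
      using step[OF subset_refl K, of "inverse (real (Suc 0))"] by (auto simp: P_def)
    moreover have "\<exists>S'. P (Suc n) S' \<and> S' \<subseteq> S" if "P n S" for n S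
    proof -
      have "S \<subseteq> K" "\<not> finitely_covered S" using that by (auto simp: P_def)
      from step[OF this, of "inverse (real (Suc (Suc n)))"] obtain S' where
        "S' \<subseteq> S" "\<not> finitely_covered S'" "\<exists>c. \<forall>x\<in>S'. N (x - c) \<le> inverse (real (Suc (Suc n)))"
        by auto
      then show ?thesis using \<open>S \<subseteq> K\<close> unfolding P_def by blast
    qed
    ultimately obtain S where S: "\<And>n. P n (S n)" and dec: "\<And>n. S (Suc n) \<subseteq> S n"
      using dependent_nat_choice[of P "\<lambda>n S S'. S' \<subseteq> S"] by blast
    have mono: "S m \<subseteq> S n" if "n \<le> m" for m n
      using lift_Suc_antimono_le[of S, OF dec that] .
    \<comment> \<open>The empty set is covered by the empty family, so the pieces are nonempty.\<close>
    have "finitely_covered {}" unfolding finitely_covered_def by auto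
    then have "\<exists>x. x \<in> S n" for n using S[of n] unfolding P_def by (metis ex_in_conv)
    then obtain X where X: "\<And>n. X n \<in> S n" by metis
    have diam: "N (x - y) \<le> C * (inverse (real (Suc n)) + inverse (real (Suc n)))"
      if "x \<in> S n" "y \<in> S n" for x y n
    proof -
      obtain c where "\<forall>x\<in>S n. N (x - c) \<le> inverse (real (Suc n))"
        using S[of n] unfolding P_def by blast
      then show ?thesis
        using that by (intro diff_triangle_le[of x c]) (auto simp: diff_commute[of c])
    qed
    have small: "\<exists>n. C * (inverse (real (Suc n)) + inverse (real (Suc n))) < \<epsilon>" if "\<epsilon> > 0" for \<epsilon>
    proof -
      obtain n where "inverse (real (Suc n)) < \<epsilon> / (2 * C)"
        using reals_Archimedean[of "\<epsilon> / (2 * C)"] \<open>\<epsilon> > 0\<close> const_pos by auto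
      then have "inverse (real (Suc n)) * (2 * C) < \<epsilon>"
        using const_pos by (simp add: pos_less_divide_eq)
      then have "C * (inverse (real (Suc n)) + inverse (real (Suc n))) < \<epsilon>"
        by (simp add: algebra_simps)
      then show ?thesis ..
    qed
    have "\<exists>M. \<forall>m\<ge>M. \<forall>n\<ge>M. N (X m - X n) < \<epsilon>" if \<epsilon>: "\<epsilon> > 0" for \<epsilon>
    proof -
      obtain M where M: "C * (inverse (real (Suc M)) + inverse (real (Suc M))) < \<epsilon>"
        using small[OF \<epsilon>] by blast
      have "N (X m - X n) < \<epsilon>" if "m \<ge> M" "n \<ge> M" for m n
      proof -
        have "X m \<in> S M" "X n \<in> S M" using X mono that by blast+
        from diam[OF this] M show ?thesis by linarith
      qed
      then show ?thesis by blast
    qed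
    then obtain l where "(\<lambda>n. N (X n - l)) \<longlonglongrightarrow> 0"
      using complete[of X] by blast
    then have lim: "\<exists>m\<ge>n. N (X m - l) < \<epsilon>" if "\<epsilon> > 0" for n \<epsilon>
    proof -
      have "eventually (\<lambda>m. N (X m - l) < \<epsilon>) sequentially"
        using order_tendstoD(2)[OF \<open>(\<lambda>n. N (X n - l)) \<longlonglongrightarrow> 0\<close> that] .
      then obtain m0 where "\<forall>m\<ge>m0. N (X m - l) < \<epsilon>"
        unfolding eventually_sequentially by blast
      then show ?thesis by (intro exI[of _ "max n m0"]) auto
    qed
    have "l \<in> K"
    proof (rule ccontr)
      assume "l \<notin> K"
      moreover have "openin (qn_topology N) (- K)"
        using closed unfolding closedin_def topspace_qn_topology by (simp add: Compl_eq_Diff_UNIV)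
      ultimately obtain \<epsilon> where \<epsilon>: "\<epsilon> > 0" "\<And>y. N (y - l) < \<epsilon> \<Longrightarrow> y \<in> - K"
        unfolding openin_qn_topology by blast
      obtain m where "N (X m - l) < \<epsilon>" using lim[OF \<epsilon>(1)] by blast
      then have "X m \<notin> K" using \<epsilon>(2) by blast
      then show False using X[of m] S[of m] unfolding P_def by blast
    qed
    then obtain U where U: "U \<in> \<U>" "l \<in> U" using \<U> by blast
    then obtain \<epsilon> where \<epsilon>: "\<epsilon> > 0" "\<And>y. N (y - l) < \<epsilon> \<Longrightarrow> y \<in> U"
      using \<U> unfolding openin_qn_topology by blast
    let ?\<eta> = "\<epsilon> / (2 * C)"
    have \<eta>: "?\<eta> > 0" using \<epsilon>(1) const_pos by simp
    obtain n where n: "C * (inverse (real (Suc n)) + inverse (real (Suc n))) < ?\<eta>"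
      using small[OF \<eta>] by blast
    obtain m where m: "m \<ge> n" "N (X m - l) < ?\<eta>" using lim[OF \<eta>] by blast
    have "S n \<subseteq> U"
    proof
      fix x assume x: "x \<in> S n"
      have "X m \<in> S n" using X mono[OF m(1)] by blast
      from diam[OF x this] n have "N (x - X m) < ?\<eta>" by linarith
      have "N (x - l) \<le> C * (N (x - X m) + N (X m - l))" by (rule diff_triangle)
      also have "\<dots> < C * (?\<eta> + ?\<eta>)"
        using \<open>N (x - X m) < ?\<eta>\<close> m(2) const_pos
        by (intro mult_strict_left_mono add_strict_mono)
      also have "\<dots> = \<epsilon>" using const_pos by (simp add: field_simps)
      finally show "x \<in> U" by (rule \<epsilon>(2))
    qed
    then have "finitely_covered (S n)"
      unfolding finitely_covered_def using U(1) by (intro exI[of _ "{U}"]) auto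
    then show False using S[of n] unfolding P_def by blast
  qed
qed

lemma (in quasi_banach) compactin_closure_iff_totally_bounded:
  "compactin (qn_topology N) (qn_topology N closure_of A) \<longleftrightarrow>
    (\<forall>\<epsilon>>0. \<exists>k. covered_by_balls N k \<epsilon> A)"
proof (intro iffI allI impI)
  fix \<epsilon> :: real
  assume "compactin (qn_topology N) (qn_topology N closure_of A)" "\<epsilon> > 0"
  then obtain k where "covered_by_balls N k \<epsilon> (qn_topology N closure_of A)"
    using covered_by_balls_if_compactin by blast
  moreover have "A \<subseteq> qn_topology N closure_of A"
    by (intro closure_of_subset) (simp add: topspace_qn_topology)
  ultimately show "\<exists>k. covered_by_balls N k \<epsilon> A"
    using covered_by_balls_mono by blast
next
  assume tb: "\<forall>\<epsilon>>0. \<exists>k. covered_by_balls N k \<epsilon> A"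
  show "compactin (qn_topology N) (qn_topology N closure_of A)"
  proof (rule compactin_if_closed_totally_bounded[OF closedin_closure_of])
    fix \<epsilon> :: real assume "\<epsilon> > 0"
    let ?\<eta> = "\<epsilon> / (2 * C)"
    have \<eta>: "?\<eta> > 0" using \<open>\<epsilon> > 0\<close> const_pos by simp
    then obtain k where "covered_by_balls N k ?\<eta> A" using tb by blast
    from covered_by_balls_closure[OF this \<eta>]
    have "covered_by_balls N k (C * (?\<eta> + ?\<eta>)) (qn_topology N closure_of A)" .
    moreover have "C * (?\<eta> + ?\<eta>) = \<epsilon>" using const_pos by (simp add: field_simps)
    ultimately show "\<exists>k. covered_by_balls N k \<epsilon> (qn_topology N closure_of A)" by metis
  qed
qed

lemma (in quasi_norm) entropy_number_tendsto_0_iff: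
  assumes bdd: "\<And>x. x \<in> unit_ball NX \<Longrightarrow> N (T x) \<le> K"
  shows "(\<lambda>n. entropy_number NX scale N n T) \<longlonglongrightarrow> 0 \<longleftrightarrow>
    (\<forall>\<epsilon>>0. \<exists>k. covered_by_balls N k \<epsilon> (T ` unit_ball NX))"
proof (intro iffI allI impI)
  fix \<epsilon> :: real
  assume lim: "(\<lambda>n. entropy_number NX scale N n T) \<longlonglongrightarrow> 0" and "\<epsilon> > 0"
  then obtain n where "entropy_number NX scale N n T < \<epsilon>"
    using order_tendstoD(2)[OF lim] eventually_sequentially by (metis order_refl)
  from covered_by_balls_if_entropy_number_less[where T = T, OF bdd this]
  show "\<exists>k. covered_by_balls N k \<epsilon> (T ` unit_ball NX)" by blast
next
  assume tb: "\<forall>\<epsilon>>0. \<exists>k. covered_by_balls N k \<epsilon> (T ` unit_ball NX)"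
  show "(\<lambda>n. entropy_number NX scale N n T) \<longlonglongrightarrow> 0"
  proof (rule order_tendstoI)
    fix a :: real assume "a < 0"
    then have "a < entropy_number NX scale N n T" for n
      using entropy_number_nonneg[where NX = NX and T = T, OF bdd, where n = n] by linarith
    then show "eventually (\<lambda>n. a < entropy_number NX scale N n T) sequentially" by simp
  next
    fix a :: real assume "a > 0"
    then obtain k where k: "covered_by_balls N k (a / 2) (T ` unit_ball NX)"
      using tb half_gt_zero by blast
    have "entropy_number NX scale N n T < a" if "n \<ge> Suc k" for n
    proof -
      have "k < 2 ^ k" by (rule less_exp)
      also have "(2::nat) ^ k \<le> 2 ^ (n - 1)"
        using that by (intro power_increasing) auto
      finally have "covered_by_balls N (2 ^ (n - 1)) (a / 2) (T ` unit_ball NX)"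
        using k by (intro covered_by_balls_mono[OF k _ order_refl subset_refl] less_imp_le)
      then have "entropy_number NX scale N n T \<le> a / 2"
        using \<open>a > 0\<close> by (intro entropy_number_le) auto
      then show ?thesis using \<open>a > 0\<close> by linarith
    qed
    then show "eventually (\<lambda>n. entropy_number NX scale N n T < a) sequentially"
      unfolding eventually_sequentially by blast
  qed
qed

text \<open>
  By homogeneity a covering of the image of the unit ball can be dilated to the image of any
  bounded set.
\<close>

lemma compact_operator_iff_totally_bounded:
  assumes X: "quasi_norm sX NX CX" and Y: "quasi_banach sY NY CY"
    and T: "Vector_Spaces.linear sX sY T"
  shows "compact_operator NX NY T \<longleftrightarrow> (\<forall>\<epsilon>>0. \<exists>k. covered_by_balls NY k \<epsilon> (T ` unit_ball NX))"
proof -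
  interpret X: quasi_norm sX NX CX by fact
  interpret Y: quasi_banach sY NY CY by fact
  interpret T: Vector_Spaces.linear sX sY T by fact
  have bounded: "\<exists>M. \<forall>x\<in>unit_ball NX. NX x \<le> M"
    by (rule exI[of _ 1]) (simp add: unit_ball_def)
  have dilate: "\<exists>k. covered_by_balls NY k \<epsilon> (T ` A)"
    if tb: "\<forall>\<epsilon>>0. \<exists>k. covered_by_balls NY k \<epsilon> (T ` unit_ball NX)"
      and A: "\<And>x. x \<in> A \<Longrightarrow> NX x \<le> M" and "\<epsilon> > 0" for A M \<epsilon>
  proof -
    \<comment> \<open>The bound \<open>M\<close> may be zero or negative, which cannot serve as a factor of dilation.\<close>
    define t where "t = max M 1"
    have t: "t > 0" "M \<le> t" by (auto simp: t_def)
    have "\<epsilon> / t > 0" using \<open>\<epsilon> > 0\<close> t(1) by simp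
    then obtain k where "covered_by_balls NY k (\<epsilon> / t) (T ` unit_ball NX)" using tb by blast
    then obtain F where F: "finite F" "card F \<le> k"
        "\<And>y. y \<in> T ` unit_ball NX \<Longrightarrow> \<exists>c\<in>F. NY (y - c) \<le> \<epsilon> / t"
      by (rule covered_by_ballsE) blast
    have "\<exists>c\<in>sY (of_real t) ` F. NY (T x - c) \<le> \<epsilon>" if "x \<in> A" for x
    proof -
      have "NX (x - 0) \<le> t" using A[OF that] t(2) by simp
      then obtain v where v: "v \<in> unit_ball NX" "x = 0 + sX (of_real t) v"
        using X.mem_translated_ball[OF t(1)] by blast
      obtain c where c: "c \<in> F" "NY (T v - c) \<le> \<epsilon> / t" using F(3) v(1) by blast
      have "T x - sY (of_real t) c = sY (of_real t) (T v - c)"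
        by (simp add: v(2) T.scale Y.scale_right_diff_distrib)
      then have "NY (T x - sY (of_real t) c) = t * NY (T v - c)"
        using t(1) by (simp add: Y.norm_scale_of_real)
      also have "\<dots> \<le> \<epsilon>" using c(2) t(1) by (simp add: field_simps)
      finally show ?thesis using c(1) by blast
    qed
    then have "covered_by_balls NY (card (sY (of_real t) ` F)) \<epsilon> (T ` A)"
      unfolding covered_by_balls_def using F(1)
      by (intro exI[of _ "sY (of_real t) ` F"]) auto
    then show ?thesis ..
  qed
  show ?thesis
    unfolding compact_operator_def Y.compactin_closure_iff_totally_bounded
  proof (intro iffI allI impI)
    fix \<epsilon> :: real
    assume "\<forall>A. (\<exists>M. \<forall>x\<in>A. NX x \<le> M) \<longrightarrow> (\<forall>\<epsilon>>0. \<exists>k. covered_by_balls NY k \<epsilon> (T ` A))"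
      and "\<epsilon> > 0"
    with bounded show "\<exists>k. covered_by_balls NY k \<epsilon> (T ` unit_ball NX)" by simp
  next
    fix A and \<epsilon> :: real
    assume tb: "\<forall>\<epsilon>>0. \<exists>k. covered_by_balls NY k \<epsilon> (T ` unit_ball NX)"
      and A: "\<exists>M. \<forall>x\<in>A. NX x \<le> M" and "\<epsilon> > 0"
    obtain M where "\<And>x. x \<in> A \<Longrightarrow> NX x \<le> M" using A by blast
    then show "\<exists>k. covered_by_balls NY k \<epsilon> (T ` A)"
      by (rule dilate[OF tb _ \<open>\<epsilon> > 0\<close>])
  qed
qed

section \<open>Properties of the entropy numbers\<close>

theorem theorem14:
  fixes sX :: "'k::real_normed_field \<Rightarrow> 'a::ab_group_add \<Rightarrow> 'a"
    and sY :: "'k \<Rightarrow> 'b::ab_group_add \<Rightarrow> 'b"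
    and sW :: "'k \<Rightarrow> 'c::ab_group_add \<Rightarrow> 'c"
    and NX :: "'a \<Rightarrow> real" and NY :: "'b \<Rightarrow> real" and NW :: "'c \<Rightarrow> real"
    and CX CY CW :: real and T :: "'a \<Rightarrow> 'b"
  assumes X: "quasi_banach sX NX CX"
    and Y: "quasi_banach sY NY CY"
    and W: "quasi_banach sW NW CW"
    and T: "T \<in> bounded_operators sX NX sY NY"
  shows
    "(CY * entropy_number NX sY NY 1 T \<ge> operator_norm NX NY T \<and>
      operator_norm NX NY T \<ge> entropy_number NX sY NY 1 T \<and>
      (\<forall>n\<ge>1. entropy_number NX sY NY n T \<ge> entropy_number NX sY NY (n + 1) T) \<and>
      (\<forall>n\<ge>1. entropy_number NX sY NY n T \<ge> 0)) \<and>
     (\<forall>S\<in>bounded_operators sX NX sY NY. \<forall>m\<ge>1. \<forall>n\<ge>1.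
      entropy_number NX sY NY (m + n - 1) (\<lambda>x. S x + T x)
        \<le> CY * (entropy_number NX sY NY m S + entropy_number NX sY NY n T)) \<and>
     (\<forall>\<rho> N'. rho_norm sY N' \<rho> \<and> equivalent_norms NY N' \<longrightarrow>
      (\<forall>S\<in>bounded_operators sX NX sY NY. \<forall>m\<ge>1. \<forall>n\<ge>1.
        entropy_number NX sY N' (m + n - 1) (\<lambda>x. S x + T x) powr \<rho>
          \<le> entropy_number NX sY N' m S powr \<rho> + entropy_number NX sY N' n T powr \<rho>)) \<and>
     (\<forall>S\<in>bounded_operators sY NY sW NW. \<forall>m\<ge>1. \<forall>n\<ge>1.
      entropy_number NX sW NW (m + n - 1) (\<lambda>x. S (T x))
        \<le> entropy_number NY sW NW m S * entropy_number NX sY NY n T) \<and>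
     (compact_operator NX NY T \<longleftrightarrow> (\<lambda>n. entropy_number NX sY NY n T) \<longlonglongrightarrow> 0)"
proof -
  interpret X: quasi_banach sX NX CX by fact
  interpret Y: quasi_banach sY NY CY by fact
  interpret W: quasi_banach sW NW CW by fact
  have qX: "quasi_norm sX NX CX" and qY: "quasi_norm sY NY CY" and qW: "quasi_norm sW NW CW"
    by unfold_locales
  have lin: "Vector_Spaces.linear sX sY T"
    using T by (simp add: bounded_operators_def)
  interpret T: Vector_Spaces.linear sX sY T by (rule lin)
  have bdd_XY: "\<exists>K. \<forall>x\<in>unit_ball NX. NY (S x) \<le> K" if "S \<in> bounded_operators sX NX sY NY" for S
    using that X.nonneg by (intro bounded_on_unit_ball) (auto simp: bounded_operators_def)
  obtain L where L: "\<And>x. x \<in> unit_ball NX \<Longrightarrow> NY (T x) \<le> L"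
    using bdd_XY[OF T] by blast
  have ne: "unit_ball NX \<noteq> {}"
    using X.norm_zero by (auto simp: unit_ball_def intro!: exI[of _ 0])
  have sym: "- T x \<in> T ` unit_ball NX" if "x \<in> unit_ball NX" for x
  proof (rule image_eqI)
    show "- T x = T (- x)" by (simp add: T.neg)
    show "- x \<in> unit_ball NX" using that by (simp add: unit_ball_def X.norm_minus)
  qed
  have monotone: "(CY * entropy_number NX sY NY 1 T \<ge> operator_norm NX NY T \<and>
      operator_norm NX NY T \<ge> entropy_number NX sY NY 1 T \<and>
      (\<forall>n\<ge>1. entropy_number NX sY NY n T \<ge> entropy_number NX sY NY (n + 1) T) \<and>
      (\<forall>n\<ge>1. entropy_number NX sY NY n T \<ge> 0))"
    using Y.operator_norm_le_entropy_number[where T = T, OF L ne sym]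
      Y.entropy_number_le_operator_norm[where T = T, OF L ne]
      Y.entropy_number_antimono[where T = T, OF L]
      Y.entropy_number_nonneg[where NX = NX and T = T, OF L] by auto
  have add: "\<forall>S\<in>bounded_operators sX NX sY NY. \<forall>m\<ge>1. \<forall>n\<ge>1.
      entropy_number NX sY NY (m + n - 1) (\<lambda>x. S x + T x)
        \<le> CY * (entropy_number NX sY NY m S + entropy_number NX sY NY n T)"
  proof (intro ballI allI impI)
    fix S and m n :: nat
    assume "S \<in> bounded_operators sX NX sY NY" and mn: "1 \<le> m" "1 \<le> n"
    then obtain K where K: "\<And>x. x \<in> unit_ball NX \<Longrightarrow> NY (S x) \<le> K"
      using bdd_XY by blast
    show "entropy_number NX sY NY (m + n - 1) (\<lambda>x. S x + T x)
        \<le> CY * (entropy_number NX sY NY m S + entropy_number NX sY NY n T)"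
      by (rule Y.entropy_number_add_le[where S = S and T = T, OF K L mn])
  qed
  have add_rho: "\<forall>\<rho> N'. rho_norm sY N' \<rho> \<and> equivalent_norms NY N' \<longrightarrow>
      (\<forall>S\<in>bounded_operators sX NX sY NY. \<forall>m\<ge>1. \<forall>n\<ge>1.
        entropy_number NX sY N' (m + n - 1) (\<lambda>x. S x + T x) powr \<rho>
          \<le> entropy_number NX sY N' m S powr \<rho> + entropy_number NX sY N' n T powr \<rho>)"
  proof (intro ballI allI impI)
    fix \<rho> N' S and m n :: nat
    assume N': "rho_norm sY N' \<rho> \<and> equivalent_norms NY N'"
      and S: "S \<in> bounded_operators sX NX sY NY" and mn: "1 \<le> m" "1 \<le> n"
    interpret R: rho_norm sY N' \<rho> using N' by blast
    obtain c where c: "\<And>y. N' y \<le> c * NY y"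
      using N' unfolding equivalent_norms_def by blast
    have bdd: "\<exists>K. \<forall>x\<in>unit_ball NX. N' (S x) \<le> K" if S: "S \<in> bounded_operators sX NX sY NY" for S
    proof -
      obtain K where K: "\<And>x. x \<in> unit_ball NX \<Longrightarrow> NY (S x) \<le> K" using bdd_XY[OF S] by blast
      have "N' (S x) \<le> \<bar>c\<bar> * K" if "x \<in> unit_ball NX" for x
      proof -
        have "c * NY (S x) \<le> \<bar>c\<bar> * K"
          using K[OF that] Y.nonneg[of "S x"] by (intro mult_mono) auto
        with c[of "S x"] show ?thesis by linarith
      qed
      then show ?thesis by blast
    qed
    obtain K' where K': "\<And>x. x \<in> unit_ball NX \<Longrightarrow> N' (S x) \<le> K'" using bdd[OF S] by blast
    obtain L' where L': "\<And>x. x \<in> unit_ball NX \<Longrightarrow> N' (T x) \<le> L'" using bdd[OF T] by blast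
    show "entropy_number NX sY N' (m + n - 1) (\<lambda>x. S x + T x) powr \<rho>
          \<le> entropy_number NX sY N' m S powr \<rho> + entropy_number NX sY N' n T powr \<rho>"
      by (rule R.entropy_number_add_powr_le[where S = S and T = T, OF K' L' mn])
  qed
  have mult: "\<forall>S\<in>bounded_operators sY NY sW NW. \<forall>m\<ge>1. \<forall>n\<ge>1.
      entropy_number NX sW NW (m + n - 1) (\<lambda>x. S (T x))
        \<le> entropy_number NY sW NW m S * entropy_number NX sY NY n T"
  proof (intro ballI allI impI)
    fix S and m n :: nat
    assume S: "S \<in> bounded_operators sY NY sW NW" and mn: "1 \<le> m" "1 \<le> n"
    then have lin_S: "Vector_Spaces.linear sY sW S" and bdd_S: "\<exists>K. \<forall>x. NW (S x) \<le> K * NY x"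
      by (auto simp: bounded_operators_def)
    obtain K where K: "\<And>x. x \<in> unit_ball NY \<Longrightarrow> NW (S x) \<le> K"
      using bounded_on_unit_ball[where N = NW and T = S and M = NY, OF bdd_S] Y.nonneg by blast
    show "entropy_number NX sW NW (m + n - 1) (\<lambda>x. S (T x))
        \<le> entropy_number NY sW NW m S * entropy_number NX sY NY n T"
      by (rule entropy_number_compose_le[where S = S and T = T, OF qY qW lin_S K L mn])
  qed
  have compact: "compact_operator NX NY T \<longleftrightarrow> (\<lambda>n. entropy_number NX sY NY n T) \<longlonglongrightarrow> 0"
    using compact_operator_iff_totally_bounded[OF qX Y lin]
      Y.entropy_number_tendsto_0_iff[where T = T, OF L] by simp
  show ?thesis
    by (rule conjI[OF monotone conjI[OF add conjI[OF add_rho conjI[OF mult compact]]]])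
qed

end
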